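(* For every $\alpha\in\mathbb{R}\setminus\mathbb{Q}(\mathbf{H}_4)$, $$K(\alpha)\le K(1)=\frac{\sqrt2+1}{2}.$$
   Context: The Hecke group $\mathbf{H}_4$ is the subgroup of $\mathrm{PSL}_2(\mathbb{R})$ generated by $\begin{pmatrix}1&\sqrt2\\0&1\end{pmatrix}$ and $\begin{pmatrix}0&-1\\1&0\end{pmatrix}$. The set $\mathbb{Q}(\mathbf{H}_4)\subset \mathbb{R}\cup\{\infty\}$ is the set of all $p/q$ such that $\begin{pmatrix} p & r \\ q & s \end{pmatrix}\in\mathbf{H}_4$ for some $r,s$; its finite elements form the set $\sqrt2\,\mathbb{Q}$. Writing $p/q\in\mathbb{Q}(\mathbf{H}_4)$ always means the normalized form: $(p,q)$ is the first column of a matrix in $\mathbf{H}_4$ with $q>0$. Explicitly, either $p=a$, $q=\sqrt2\,c$ with $a,c\in\mathbb{Z}$, $c>0$, $\gcd(a,2c)=1$, or $p=\sqrt2\,a$, $q=c$ with $a,c\in\mathbb{Z}$, $c>0$, $\gcd(2a,c)=1$. For a real number $\alpha$, $K(\alpha)$ is the infimum of those $K>0$ such that for all sufficiently large real $N$ there is $p/q\in\mathbb{Q}(\mathbf{H}_4)$ with $|q\alpha-p|<\frac{K}{N}$ and $1\le q\le N$. *)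

theory Defs
  imports "HOL-Analysis.Analysis" "HOL-Algebra.Algebra"
begin

definition SL2R :: "(real^2^2) monoid" where
  "SL2R = \<lparr>carrier = {A. det A = 1}, monoid.mult = (**), one = mat 1\<rparr>"

definition center2 :: "(real^2^2) set" where
  "center2 = {mat 1, - mat 1}"

definition PSL2R :: "(real^2^2) set monoid" where
  "PSL2R = SL2R Mod center2"

definition mat2 :: "real \<Rightarrow> real \<Rightarrow> real \<Rightarrow> real \<Rightarrow> real^2^2" where
  "mat2 a b c d = vector [vector [a, b], vector [c, d]]"

definition proj :: "real^2^2 \<Rightarrow> (real^2^2) set" where
  "proj A = center2 #>\<^bsub>SL2R\<^esub> A"

definition H4 :: "(real^2^2) set set" where
  "H4 = generate PSL2R {proj (mat2 1 (sqrt 2) 0 1), proj (mat2 0 (-1) 1 0)}"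

text \<open>
  A real matrix lies in the group when it represents one of its elements, that is, when it has
  determinant one and its class modulo sign is in \<^const>\<open>H4\<close>.
\<close>
definition in_H4 :: "real^2^2 \<Rightarrow> bool" where
  "in_H4 A \<longleftrightarrow> A \<in> carrier SL2R \<and> proj A \<in> H4"

text \<open>
  The single point at infinity of the projective line is represented by the value \<open>\<infinity>\<close> of
  \<^typ>\<open>ereal\<close>; the value \<open>-\<infinity>\<close> never occurs.
\<close>
definition Q_H4 :: "ereal set" where
  "Q_H4 = {if q = 0 then \<infinity> else ereal (p / q) | p q. \<exists>r s. in_H4 (mat2 p r q s)}"

definition normalized :: "real \<Rightarrow> real \<Rightarrow> bool" where
  "normalized p q \<longleftrightarrow> q > 0 \<and> (\<exists>r s. in_H4 (mat2 p r q s))"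

text \<open>The infimum is taken in \<^typ>\<open>ereal\<close>, so that it is \<open>\<infinity>\<close> if no \<open>K\<close> is admissible.\<close>
definition K_const :: "real \<Rightarrow> ereal" where
  "K_const \<alpha> = Inf (ereal ` {K. K > 0 \<and>
     (\<forall>\<^sub>F N in at_top. \<exists>p q. normalized p q \<and> \<bar>q * \<alpha> - p\<bar> < K / N \<and> 1 \<le> q \<and> q \<le> N)})"

lemma group_SL2R: "group SL2R"
proof (rule groupI)
  fix A assume "A \<in> carrier SL2R"
  then have d: "det A = 1" by (simp add: SL2R_def)
  then have "invertible A" by (simp add: invertible_det_nz)
  then obtain B where B: "B ** A = mat 1" by (auto simp: invertible_def)
  then have "det B * det A = 1" by (metis det_mul det_I)
  with d B show "\<exists>B\<in>carrier SL2R. B \<otimes>\<^bsub>SL2R\<^esub> A = \<one>\<^bsub>SL2R\<^esub>"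
    by (auto simp: SL2R_def)
qed (auto simp: SL2R_def det_mul matrix_mul_assoc)

lemma normal_center2: "center2 \<lhd> SL2R"
proof -
  interpret group SL2R by (rule group_SL2R)
  have neg: "(- mat 1) ** A = - A" "A ** (- mat 1) = - A" for A :: "real^2^2"
    by (simp_all add: vec_eq_iff matrix_matrix_mult_def mat_def sum_2 forall_2)
  have sub: "center2 \<subseteq> carrier SL2R"
    by (auto simp: center2_def SL2R_def det_2 mat_def)
  have "subgroup center2 SL2R"
  proof (rule subgroupI)
    fix A assume A: "A \<in> center2"
    then have "A \<otimes>\<^bsub>SL2R\<^esub> A = \<one>\<^bsub>SL2R\<^esub>"
      by (auto simp: center2_def SL2R_def neg)
    then have "inv\<^bsub>SL2R\<^esub> A = A" using A sub by (metis inv_equality subsetD)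
    with A show "inv\<^bsub>SL2R\<^esub> A \<in> center2" by simp
  qed (use sub in \<open>auto simp: center2_def SL2R_def neg\<close>)
  moreover have "A #>\<^bsub>SL2R\<^esub> x = x <#\<^bsub>SL2R\<^esub> A" if "A = center2" for A x
    using that by (auto simp: r_coset_def l_coset_def center2_def SL2R_def neg)
  ultimately show ?thesis by (auto intro: normalI)
qed

lemma group_PSL2R: "group PSL2R"
  unfolding PSL2R_def by (rule normal.factorgroup_is_group[OF normal_center2])

lemma proj_carrier: "A \<in> carrier SL2R \<Longrightarrow> proj A \<in> carrier PSL2R"
  by (auto simp: PSL2R_def FactGroup_def RCOSETS_def proj_def)

lemma det_mat2: "det (mat2 a b c d) = a * d - b * c"
  by (simp add: mat2_def det_2)

lemma subgroup_H4: "subgroup H4 PSL2R"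
  unfolding H4_def
  by (rule group.generate_is_subgroup[OF group_PSL2R])
     (auto intro!: proj_carrier simp: SL2R_def det_mat2)

end

(*
  Upper bound: descend through the tessellation by ideal quadrilaterals to the last edge (u, v) that
  separates alpha and has both denominators at most N. If q, q' are the denominators and a, b the
  distances |q alpha - p| of u and v, then q b + q' a = 1. Some vertex of the next edge has
  denominator above N; if both sqrt 2 u + v and u + sqrt 2 v do, then 2 N < (sqrt 2 + 1) (q + q'),
  and min a b <= 1 / (q + q') gives the bound. In all other cases some vertex gives the bound 1 / N.

  Lower bound at alpha = 1: up to signs, p + q and p - q are conjugates in Z[sqrt 2]. If
  |p - q| < (sqrt 2 - 1)^n and q is less than ((sqrt 2 + 1)^(n+1) - (sqrt 2 - 1)^(n+1)) / 2, then
  multiplying p + q by the unit (sqrt 2 - 1)^n leaves only 1 + sqrt 2, for which q is too large.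
*)
theory Submission imports Defs "HOL-Real_Asymp.Real_Asymp" begin

section \<open>Matrices representing elements of \<open>H4\<close>, up to sign\<close>

lemma mat2_component [simp]:
  "mat2 a b c d $ 1 $ 1 = a" "mat2 a b c d $ 1 $ 2 = b"
  "mat2 a b c d $ 2 $ 1 = c" "mat2 a b c d $ 2 $ 2 = d"
  by (simp_all add: mat2_def)

lemma mat2_mult:
  "mat2 a b c d ** mat2 e f g h = mat2 (a*e + b*g) (a*f + b*h) (c*e + d*g) (c*f + d*h)"
  by (simp add: vec_eq_iff forall_2 matrix_matrix_mult_def sum_2)

lemma mat2_id: "mat2 1 0 0 1 = mat 1"
  by (simp add: vec_eq_iff forall_2 mat_def)

lemma mat2_uminus: "- mat2 a b c d = mat2 (-a) (-b) (-c) (-d)"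
  by (simp add: vec_eq_iff forall_2)

lemma proj_mult:
  assumes "A \<in> carrier SL2R" "B \<in> carrier SL2R"
  shows "proj A \<otimes>\<^bsub>PSL2R\<^esub> proj B = proj (A ** B)"
  using normal.rcos_sum[OF normal_center2 assms]
  by (simp add: PSL2R_def FactGroup_def proj_def SL2R_def)

lemma one_PSL2R: "\<one>\<^bsub>PSL2R\<^esub> = proj (mat 1)"
  by (auto simp: PSL2R_def FactGroup_def proj_def r_coset_def SL2R_def)

lemma proj_eq: "proj A = {A, - A}"
proof -
  have "(- mat 1) ** A = - A"
    by (simp add: vec_eq_iff matrix_matrix_mult_def mat_def sum_2 forall_2)
  then show ?thesis
    by (auto simp: proj_def r_coset_def center2_def SL2R_def)
qed

lemma in_H4_mult: "in_H4 A \<Longrightarrow> in_H4 B \<Longrightarrow> in_H4 (A ** B)"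
  using subgroup.m_closed[OF subgroup_H4, of "proj A" "proj B"]
  by (auto simp: in_H4_def proj_mult SL2R_def det_mul)

lemma in_H4_one: "in_H4 (mat 1)"
  using subgroup.one_closed[OF subgroup_H4] by (simp add: in_H4_def one_PSL2R SL2R_def)

lemma in_H4_uminus: "in_H4 (- A)" if "in_H4 A" for A
  using that by (auto simp: in_H4_def proj_eq SL2R_def det_2 insert_commute)

lemma inv_proj:
  assumes "A \<in> carrier SL2R" "B \<in> carrier SL2R" "B ** A = mat 1"
  shows "inv\<^bsub>PSL2R\<^esub> proj A = proj B"
  by (rule group.inv_equality[OF group_PSL2R])
     (use assms in \<open>auto simp: proj_mult proj_carrier one_PSL2R\<close>)

lemma in_H4_inverse:
  assumes "in_H4 A" and "B \<in> carrier SL2R" and "B ** A = mat 1"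
  shows "in_H4 B"
  using subgroup.m_inv_closed[OF subgroup_H4, of "proj A"] inv_proj[of A B] assms
  by (auto simp: in_H4_def)

lemma in_H4_translation: "in_H4 (mat2 1 (sqrt 2) 0 1)"
  by (auto simp: in_H4_def H4_def SL2R_def det_mat2 intro: generate.incl)

lemma in_H4_inversion: "in_H4 (mat2 0 (-1) 1 0)"
  by (auto simp: in_H4_def H4_def SL2R_def det_mat2 intro: generate.incl)

lemma in_H4_translation_inverse: "in_H4 (mat2 1 (- sqrt 2) 0 1)"
  by (rule in_H4_inverse[OF in_H4_translation])
     (simp_all add: SL2R_def det_mat2 mat2_mult mat2_id)

lemma in_H4_shift: "in_H4 (mat2 a b c d) \<Longrightarrow> in_H4 (mat2 a (sqrt 2 * a + b) c (sqrt 2 * c + d))"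
  using in_H4_mult[OF _ in_H4_translation, of "mat2 a b c d"] by (simp add: mat2_mult mult.commute)

lemma in_H4_swap: "in_H4 (mat2 a b c d) \<Longrightarrow> in_H4 (mat2 b (-a) d (-c))"
  using in_H4_mult[OF _ in_H4_inversion, of "mat2 a b c d"] by (simp add: mat2_mult)

lemma in_H4_swap': "in_H4 (mat2 a b c d) \<Longrightarrow> in_H4 (mat2 (-b) a (-d) c)"
  using in_H4_uminus[OF in_H4_swap] by (simp add: mat2_uminus)

text \<open>
  Geometrically, the columns \<open>u, v\<close> of a matrix of the group form an edge of the tessellation
  by ideal quadrilaterals; the other two vertices of the adjacent quadrilateral are \<open>\<surd>2 u + v\<close> and
  \<open>u + \<surd>2 v\<close>, and its other edges come from
  \<open>in_H4_shift\<close> and the two rules below.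
\<close>

lemma in_H4_edge_left:
  assumes "in_H4 (mat2 p p' q q')"
  shows "in_H4 (mat2 (p + sqrt 2 * p') p' (q + sqrt 2 * q') q')"
proof -
  have "in_H4 (mat2 p' (- p - sqrt 2 * p') q' (- q - sqrt 2 * q'))"
    using in_H4_mult[OF in_H4_swap[OF assms] in_H4_translation_inverse]
    by (simp add: mat2_mult algebra_simps)
  from in_H4_swap'[OF this] show ?thesis by (simp add: algebra_simps)
qed

lemma in_H4_edge_middle:
  assumes "in_H4 (mat2 p p' q q')"
  shows "in_H4 (mat2 (sqrt 2 * p + p') (p + sqrt 2 * p') (sqrt 2 * q + q') (q + sqrt 2 * q'))"
  \<comment> \<open>With s = \<open>sqrt 2\<close>, the columns run through (u, v), (u, s u + v), (s
    u + v, -u) and (s u + v, u + s v), the last because s * s - 1 = 1.\<close>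
  using in_H4_shift[OF in_H4_swap[OF in_H4_shift[OF assms]]] by (simp add: algebra_simps)

text \<open>Supplies the edges from infinity to the multiples of \<open>sqrt 2\<close>, where the
  descent starts.\<close>

lemma in_H4_power_translation: "in_H4 (mat2 1 (sqrt 2 * of_int k) 0 1)"
proof (induction k rule: int_induct[where k = 0])
  case base
  then show ?case by (simp add: mat2_id in_H4_one)
next
  case (step1 i)
  then show ?case using in_H4_shift[OF step1(2)] by (simp add: algebra_simps)
next
  case (step2 i)
  then show ?case using in_H4_mult[OF step2(2) in_H4_translation_inverse]
    by (simp add: algebra_simps mat2_mult)
qed

section \<open>Shape of the matrix entries\<close>

text \<open>An invariant of the generation of \<open>H4\<close>. It puts p + q and p - q in
  Z[sqrt 2] for every normalized fraction p/q, which the lower bound rests on.\<close>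

definition alternating_entries :: "real^2^2 \<Rightarrow> bool" where
  "alternating_entries A \<longleftrightarrow> (\<exists>a b c d :: int.
     A = mat2 (of_int a) (sqrt 2 * of_int b) (sqrt 2 * of_int c) (of_int d) \<or>
     A = mat2 (sqrt 2 * of_int a) (of_int b) (of_int c) (sqrt 2 * of_int d))"

lemma alternating_entriesI:
  "alternating_entries (mat2 (of_int a) (sqrt 2 * of_int b) (sqrt 2 * of_int c) (of_int d))"
  "alternating_entries (mat2 (sqrt 2 * of_int a) (of_int b) (of_int c) (sqrt 2 * of_int d))"
  unfolding alternating_entries_def by blast+

lemma alternating_entries_uminus: "alternating_entries (- A)" if "alternating_entries A"
  using that alternating_entriesI[of "- _" "- _" "- _" "- _"]
  unfolding alternating_entries_def[of A] by (auto simp: mat2_uminus)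

text \<open>The two shapes multiply like the elements of Z/2: equal shapes give the first, different
  shapes the second.\<close>

lemma alternating_entries_mult:
  assumes "alternating_entries A" "alternating_entries B"
  shows "alternating_entries (A ** B)"
proof -
  have s: "sqrt 2 * x * (sqrt 2 * y) = 2 * (x * y)" for x y :: real
    by simp
  have 1: "alternating_entries (mat2 w x y z)"
    if "w = of_int a" "x = sqrt 2 * of_int b" "y = sqrt 2 * of_int c" "z = of_int d" for w x y z a b c d
    using that alternating_entriesI(1) by simp
  have 2: "alternating_entries (mat2 w x y z)"
    if "w = sqrt 2 * of_int a" "x = of_int b" "y = of_int c" "z = sqrt 2 * of_int d" for w x y z a b c d
    using that alternating_entriesI(2) by simp
  obtain a b c d where A: 
     "A = mat2 (of_int a) (sqrt 2 * of_int b) (sqrt 2 * of_int c) (of_int d) \<or>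
     A = mat2 (sqrt 2 * of_int a) (of_int b) (of_int c) (sqrt 2 * of_int d)"
    using assms(1) unfolding alternating_entries_def by blast
  obtain e f g h where B: 
     "B = mat2 (of_int e) (sqrt 2 * of_int f) (sqrt 2 * of_int g) (of_int h) \<or>
     B = mat2 (sqrt 2 * of_int e) (of_int f) (of_int g) (sqrt 2 * of_int h)"
    using assms(2) unfolding alternating_entries_def by blast
  from A B show ?thesis
    apply (elim disjE; simp only: mat2_mult)
    subgoal by (rule 1[of _ "a * e + 2 * b * g" _ "a * f + b * h" _ "c * e + d * g" _ "2 * c * f + d * h"]) (simp_all add: algebra_simps)
    subgoal by (rule 2[of _ "a * e + b * g" _ "a * f + 2 * b * h" _ "2 * c * e + d * g" _ "c * f + d * h"]) (simp_all add: algebra_simps)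
    subgoal by (rule 2[of _ "a * e + b * g" _ "2 * a * f + b * h" _ "c * e + 2 * d * g" _ "c * f + d * h"]) (simp_all add: algebra_simps)
    subgoal by (rule 1[of _ "2 * a * e + b * g" _ "a * f + b * h" _ "c * e + d * g" _ "c * f + 2 * d * h"]) (simp_all add: algebra_simps)
    done
qed

text \<open>Induction over the generated subgroup. All representatives of a class are treated at
  once because multiplication in the quotient is a product of sets; those of one class differ only
  by sign.\<close>

lemma alternating_entries_H4:
  assumes "C \<in> H4" "A \<in> C"
  shows "alternating_entries A"
  using assms unfolding H4_def
proof (induction arbitrary: A rule: generate.induct)
  case one
  have "alternating_entries (mat 1)"
    using alternating_entriesI(1)[of 1 0 0 1] by (simp add: mat2_id)
  with one show ?case
    using alternating_entries_uminus by (auto simp: one_PSL2R proj_eq)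
next
  case (incl C)
  have "alternating_entries (mat2 1 (sqrt 2) 0 1)" "alternating_entries (mat2 0 (-1) 1 0)"
    using alternating_entriesI(1)[of 1 1 0 1] alternating_entriesI(2)[of 0 "-1" 1 0] by simp_all
  with incl show ?case using alternating_entries_uminus by (auto simp: proj_eq)
next
  case (inv C)
  have "inv\<^bsub>PSL2R\<^esub> proj (mat2 1 (sqrt 2) 0 1) = proj (mat2 1 (- sqrt 2) 0 1)"
    by (rule inv_proj) (simp_all add: SL2R_def det_mat2 mat2_mult mat2_id)
  moreover have "inv\<^bsub>PSL2R\<^esub> proj (mat2 0 (-1) 1 0) = proj (mat2 0 1 (-1) 0)"
    by (rule inv_proj) (simp_all add: SL2R_def det_mat2 mat2_mult mat2_id)
  moreover have "alternating_entries (mat2 1 (- sqrt 2) 0 1)" "alternating_entries (mat2 0 1 (-1) 0)"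
    using alternating_entriesI(1)[of 1 "-1" 0 1] alternating_entriesI(2)[of 0 1 "-1" 0] by simp_all
  ultimately show ?case using inv alternating_entries_uminus by (auto simp: proj_eq)
next
  case (eng C D)
  then show ?case
    by (auto simp: PSL2R_def FactGroup_def set_mult_def SL2R_def intro!: alternating_entries_mult)
qed

lemma normalized_cases:
  assumes "normalized p q"
  obtains a c :: int where "p = of_int a" "q = sqrt 2 * of_int c"
  | a c :: int where "p = sqrt 2 * of_int a" "q = of_int c"
proof -
  obtain r s where "in_H4 (mat2 p r q s)" using assms by (auto simp: normalized_def)
  then have "alternating_entries (mat2 p r q s)"
    using alternating_entries_H4 by (auto simp: in_H4_def proj_eq)
  then show thesis
    unfolding alternating_entries_def using that mat2_component by metis
qed

section \<open>Descent through the edges that separate \<alpha>\<close>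

text \<open>The first column is the right endpoint of the edge: determinant 1 means p/q - p'/q' =
  1/(q q') > 0.\<close>

definition farey_edge :: "real \<Rightarrow> real \<Rightarrow> real \<Rightarrow> real \<Rightarrow> real \<Rightarrow> real \<Rightarrow> bool" where
  "farey_edge \<alpha> N p p' q q' \<longleftrightarrow> in_H4 (mat2 p p' q q') \<and> 1 \<le> q \<and> q \<le> N \<and> 1 \<le> q' \<and> q' \<le> N \<and>
     q * \<alpha> \<le> p \<and> p' \<le> q' * \<alpha>"

text \<open>Two consecutive multiples of \<open>sqrt 2\<close> enclose \<alpha>. With infinity and
  (1 + 2 k) / \<open>sqrt 2\<close> they form a quadrilateral, and the latter vertex cuts the
  interval into two edges with denominators 1 and \<open>sqrt 2\<close>.\<close>

lemma farey_edge_exists: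
  assumes "N \<ge> 2"
  shows "\<exists>p p' q q'. farey_edge \<alpha> N p p' q q'"
proof -
  define k where "k = \<lfloor>\<alpha> / sqrt 2\<rfloor>"
  have k: "sqrt 2 * of_int k \<le> \<alpha>" "\<alpha> \<le> sqrt 2 * (of_int k + 1)"
    using floor_divide_lower[of "sqrt 2" \<alpha>] floor_divide_upper[of "sqrt 2" \<alpha>]
    by (simp_all add: k_def mult.commute)
  have s: "1 \<le> sqrt 2" "sqrt 2 \<le> 2"
    using sqrt_le_D[of 2] real_sqrt_le_iff[of 2 4] by simp_all
  have ss: "sqrt 2 * (sqrt 2 * x) = 2 * x" for x :: real
    by (simp flip: mult.assoc)
  note H = in_H4_power_translation[of k]
  show ?thesis
  proof (cases "sqrt 2 * \<alpha> \<le> 1 + 2 * of_int k")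
    case True
    have "farey_edge \<alpha> N (1 + 2 * of_int k) (sqrt 2 * of_int k) (sqrt 2) 1"
      using in_H4_edge_left[OF H] True k s assms by (simp add: farey_edge_def ss)
    then show ?thesis by blast
  next
    case False
    have "farey_edge \<alpha> N (sqrt 2 + sqrt 2 * of_int k) (1 + 2 * of_int k) 1 (sqrt 2)"
      using in_H4_edge_middle[OF H] False k s assms by (simp add: farey_edge_def ss algebra_simps)
    then show ?thesis by blast
  qed
qed

text \<open>
  Each step of the descent increases the sum of denominators by at least 1, so an edge as below
  admits no further step.
\<close>

lemma terminal_farey_edge_exists:
  assumes "N \<ge> 2"
  obtains p p' q q' where "farey_edge \<alpha> N p p' q q'"
    and "\<And>r r' t t'. farey_edge \<alpha> N r r' t t' \<Longrightarrow> t + t' < q + q' + 1"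
proof -
  \<comment> \<open>The sums of denominators are real, so a greatest natural lower bound n of such a
    sum replaces a greatest sum. Every other sum is then below n + 1, hence below q + q' +
    1.\<close>
  define P where "P n \<longleftrightarrow> (\<exists>p p' q q'. farey_edge \<alpha> N p p' q q' \<and> real n \<le> q + q')" for n
  have "P 0"
    using farey_edge_exists[OF assms, of \<alpha>] unfolding P_def farey_edge_def by fastforce
  moreover have bound: "n \<le> nat \<lceil>2 * N\<rceil>" if "P n" for n
    using that unfolding P_def farey_edge_def by (auto intro!: le_nat_iff[THEN iffD2]) linarith+
  ultimately obtain n where n: "P n" "\<And>m. P m \<Longrightarrow> m \<le> n"
    using Greatest_le_nat GreatestI_nat by metis
  from n(1) obtain p p' q q' where e: "farey_edge \<alpha> N p p' q q'" "real n \<le> q + q'"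
    unfolding P_def by blast
  show thesis
  proof (rule that[OF e(1)])
    fix r r' t t' assume "farey_edge \<alpha> N r r' t t'"
    moreover have "\<not> P (Suc n)" using n(2) by fastforce
    ultimately have "t + t' < real (Suc n)" unfolding P_def by force
    with e(2) show "t + t' < q + q' + 1" by simp
  qed
qed

lemma farey_edge_normalized:
  assumes "farey_edge \<alpha> N p p' q q'"
  shows "normalized p q" "normalized p' q'"
  using assms in_H4_swap[of p p' q q'] unfolding normalized_def farey_edge_def by fastforce+

section \<open>The upper bound for all \<alpha>\<close>

lemma uniform_approximation:
  assumes "N \<ge> 2"
  shows "\<exists>p q. normalized p q \<and> 1 \<le> q \<and> q \<le> N \<and> \<bar>q * \<alpha> - p\<bar> * N \<le> (sqrt 2 + 1) / 2"
proof -
  obtain p p' q q' where e: "farey_edge \<alpha> N p p' q q'"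
    and terminal: "\<And>r r' t t'. farey_edge \<alpha> N r r' t t' \<Longrightarrow> t + t' < q + q' + 1"
    using terminal_farey_edge_exists[OF assms] by metis
  define s :: real where "s = sqrt 2"
  have s: "s * s = 2" "1 \<le> s" by (simp_all add: s_def)
  define a b where "a = p - q * \<alpha>" and "b = q' * \<alpha> - p'"
  have E: "in_H4 (mat2 p p' q q')" "1 \<le> q" "q \<le> N" "1 \<le> q'" "q' \<le> N" "0 \<le> a" "0 \<le> b"
    using e by (auto simp: farey_edge_def a_def b_def)
  have "p * q' - p' * q = 1"
    using E(1) by (simp add: in_H4_def SL2R_def det_mat2)
  then have ab: "q * b + q' * a = 1"
    by (simp add: a_def b_def algebra_simps)
  have qs: "q \<le> s * q" "q' \<le> s * q'" using E s by simp_all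
  have left: ?thesis if "b * N \<le> (s + 1) / 2"
    using that farey_edge_normalized(2)[OF e] E unfolding b_def s_def by (intro exI[of _ p'] exI[of _ q']) simp
  have right: ?thesis if "a * N \<le> (s + 1) / 2"
    using that farey_edge_normalized(1)[OF e] E unfolding a_def s_def by (intro exI[of _ p] exI[of _ q]) simp
  define w1 w2 where "w1 = s * q + q'" and "w2 = q + s * q'"
  have w: "1 \<le> w1" "1 \<le> w2" using qs E unfolding w1_def w2_def by linarith+
  \<comment> \<open>The vertices, from left to right, are v, u + s v, s u + v and u. The three cases
    place \<alpha> in the left, right and middle of the intervals between them, in this
    order.\<close>
  consider "s * b \<le> a" | "s * a \<le> b" | "a < s * b" "b < s * a" by linarith
  then show ?thesis
  proof cases
    case 1
    \<comment> \<open>Otherwise the edge (u + s v, v) would be a further step, raising the sum of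
      denominators by at least 1.\<close>
    have "w2 > N"
    proof (rule ccontr)
      assume "\<not> w2 > N"
      then have "farey_edge \<alpha> N (p + s * p') p' w2 q'"
        using in_H4_edge_left[OF E(1)] E w 1
        by (simp add: farey_edge_def s_def w2_def a_def b_def algebra_simps)
      from terminal[OF this] qs E show False unfolding w2_def by linarith
    qed
    then have "b * N \<le> b * w2" using E by (intro mult_left_mono) auto
    also have "\<dots> = q * b + q' * (s * b)" by (simp add: w2_def algebra_simps)
    also have "\<dots> \<le> 1" using ab 1 mult_left_mono[OF 1, of q'] E by linarith
    finally show ?thesis by (intro left) (use s(2) in simp)
  next
    case 2
    have "w1 > N"
    proof (rule ccontr)
      assume "\<not> w1 > N"
      then have "farey_edge \<alpha> N p (s * p + p') q w1"
        using in_H4_shift[OF E(1)] E w 2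
        by (simp add: farey_edge_def s_def w1_def a_def b_def algebra_simps)
      from terminal[OF this] qs E show False unfolding w1_def by linarith
    qed
    then have "a * N \<le> a * w1" using E by (intro mult_left_mono) auto
    also have "\<dots> = q' * a + q * (s * a)" by (simp add: w1_def algebra_simps)
    also have "\<dots> \<le> 1" using ab 2 mult_left_mono[OF 2, of q] E by linarith
    finally show ?thesis by (intro right) (use s(2) in simp)
  next
    case 3
    have mid: "in_H4 (mat2 (s * p + p') (p + s * p') w1 w2)"
      using in_H4_edge_middle[OF E(1)] by (simp add: s_def w1_def w2_def)
    have err: "s * a - b = s * p + p' - w1 * \<alpha>" "s * b - a = w2 * \<alpha> - (p + s * p')"
      by (simp_all add: a_def b_def w1_def w2_def algebra_simps)
    have big: "w1 > N \<or> w2 > N"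
    proof (rule ccontr)
      assume "\<not> (w1 > N \<or> w2 > N)"
      then have "farey_edge \<alpha> N (s * p + p') (p + s * p') w1 w2"
        using mid w 3 err by (simp add: farey_edge_def)
      from terminal[OF this] qs E show False unfolding w1_def w2_def by linarith
    qed
    have norm1: "normalized (s * p + p') w1"
      using mid w unfolding normalized_def by force
    have norm2: "normalized (p + s * p') w2"
      using in_H4_swap[OF mid] w unfolding normalized_def by force
    have N: "N \<ge> 0" using assms by simp
    consider "w1 > N" "w2 > N" | "w1 \<le> N" "w2 > N" | "w1 > N" "w2 \<le> N" using big by linarith
    then show ?thesis
    proof cases
      case 1
      define m where "m = min a b"
      have "m \<ge> 0" "m \<le> a" "m \<le> b" using E by (simp_all add: m_def)
      have "q * m \<le> q * b" "q' * m \<le> q' * a"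
        using E \<open>m \<le> a\<close> \<open>m \<le> b\<close> by (auto intro!: mult_left_mono)
      then have "m * (q + q') \<le> 1"
        using ab by (simp add: algebra_simps)
      moreover have "2 * N \<le> (s + 1) * (q + q')"
        using 1 by (simp add: w1_def w2_def algebra_simps)
      then have "m * (2 * N) \<le> m * ((s + 1) * (q + q'))"
        using \<open>m \<ge> 0\<close> by (intro mult_left_mono) auto
      moreover have "(s + 1) * (m * (q + q')) \<le> (s + 1) * 1"
        using calculation(1) s by (intro mult_left_mono) auto
      ultimately have "m * N \<le> (s + 1) / 2" by (simp add: algebra_simps)
      then show ?thesis using left right unfolding m_def by (metis min_def)
    next
      case 2
      define c where "c = s * a - b"
      define m where "m = min b c"
      have "m \<ge> 0" using E 3 by (simp add: m_def c_def)
      \<comment> \<open>The analogue of \<open>ab\<close> for the diagonal from v to s u + v, which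
        has determinant s instead of 1. The sum of its endpoints is s times the vertex u + s v, so
        the smaller error is at most 1 / \<open>w2\<close>.\<close>
      have "w1 * b + q' * c = s * (q * b + q' * a)"
        by (simp add: w1_def c_def algebra_simps)
      also have "\<dots> = s" using ab by simp
      finally have "w1 * b + q' * c = s" .
      moreover have "w1 * m \<le> w1 * b" "q' * m \<le> q' * c"
        using E w unfolding m_def by (auto intro!: mult_left_mono)
      ultimately have "m * (w1 + q') \<le> s" by (simp add: algebra_simps)
      also have "w1 + q' = s * w2" using s by (simp add: w1_def w2_def algebra_simps)
      finally have "s * (m * w2) \<le> s * 1" by (simp add: algebra_simps)
      then have "m * w2 \<le> 1" using s by simp
      moreover have "m * N \<le> m * w2" using 2 \<open>m \<ge> 0\<close> by (intro mult_left_mono) auto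
      ultimately have m: "m * N \<le> (s + 1) / 2" using s(2) by argo
      show ?thesis
      proof (cases "b \<le> c")
        case True
        then show ?thesis using left m by (simp add: m_def)
      next
        case False
        with m 2 3 w norm1 err show ?thesis unfolding s_def[symmetric]
          by (intro exI[of _ "s * p + p'"] exI[of _ w1]) (simp add: m_def c_def abs_minus_commute)
      qed
    next
      case 3
      define c where "c = s * b - a"
      define m where "m = min a c"
      have "m \<ge> 0" using E \<open>a < s * b\<close> by (simp add: m_def c_def)
      \<comment> \<open>The mirror image, with the diagonal from u + s v to u, whose endpoints sum
        to s times the vertex s u + v.\<close>
      have "w2 * a + q * c = s * (q * b + q' * a)"
        by (simp add: w2_def c_def algebra_simps)
      also have "\<dots> = s" using ab by simp
      finally have "w2 * a + q * c = s" .
      moreover have "w2 * m \<le> w2 * a" "q * m \<le> q * c"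
        using E w unfolding m_def by (auto intro!: mult_left_mono)
      ultimately have "m * (w2 + q) \<le> s" by (simp add: algebra_simps)
      also have "w2 + q = s * w1" using s by (simp add: w1_def w2_def algebra_simps)
      finally have "s * (m * w1) \<le> s * 1" by (simp add: algebra_simps)
      then have "m * w1 \<le> 1" using s by simp
      moreover have "m * N \<le> m * w1" using 3 \<open>m \<ge> 0\<close> by (intro mult_left_mono) auto
      ultimately have m: "m * N \<le> (s + 1) / 2" using s(2) by argo
      show ?thesis
      proof (cases "a \<le> c")
        case True
        then show ?thesis using right m by (simp add: m_def)
      next
        case False
        with m 3 \<open>a < s * b\<close> w norm2 err show ?thesis unfolding s_def[symmetric]
          by (intro exI[of _ "p + s * p'"] exI[of _ w2]) (simp add: m_def c_def abs_minus_commute)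
      qed
    qed
  qed
qed

text \<open>\<open>K_const\<close> asks for a strict inequality while
  \<open>uniform_approximation\<close> gives a weak one, so only constants exceeding the bound by
  some \<open>e\<close> > 0 are shown admissible, and \<open>e\<close> tends to 0.\<close>

lemma K_const_le: "K_const \<alpha> \<le> ereal ((sqrt 2 + 1) / 2)"
proof (rule ereal_le_epsilon2)
  fix e :: real assume e: "e > 0"
  have "\<forall>\<^sub>F N in at_top. \<exists>p q. normalized p q \<and>
    \<bar>q * \<alpha> - p\<bar> < ((sqrt 2 + 1) / 2 + e) / N \<and> 1 \<le> q \<and> q \<le> N"
    using eventually_ge_at_top[of "2::real"]
  proof eventually_elim
    case (elim N)
    then obtain p q where "normalized p q" "1 \<le> q" "q \<le> N" "\<bar>q * \<alpha> - p\<bar> * N \<le> (sqrt 2 + 1) / 2"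
      using uniform_approximation by blast
    moreover from this(4) e have "\<bar>q * \<alpha> - p\<bar> * N < (sqrt 2 + 1) / 2 + e" by linarith
    ultimately show ?case using elim by (auto simp: pos_less_divide_eq)
  qed
  then show "K_const \<alpha> \<le> ereal ((sqrt 2 + 1) / 2) + ereal e"
    unfolding K_const_def using e by (auto intro!: Inf_lower imageI add_pos_pos)
qed

section \<open>Arithmetic in Z[sqrt 2]\<close>

text \<open>The unit \<open>sqrt 2 - 1\<close> has the conjugate \<open>- sqrt 2 - 1\<close>, so
  multiplying by it scales the conjugate by \<open>sqrt 2 + 1\<close> in absolute value.\<close>

lemma quadratic_integer_shift:
  fixes a c :: int
  shows "\<exists>(A::int) (B::int). (a + c * sqrt 2) * (sqrt 2 - 1) ^ n = A + B * sqrt 2 \<and>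
     \<bar>a - c * sqrt 2\<bar> * (sqrt 2 + 1) ^ n = \<bar>A - B * sqrt 2\<bar>"
proof (induction n)
  case 0
  then show ?case by auto
next
  case (Suc n)
  then obtain A B :: int where IH: "(a + c * sqrt 2) * (sqrt 2 - 1) ^ n = A + B * sqrt 2"
    "\<bar>a - c * sqrt 2\<bar> * (sqrt 2 + 1) ^ n = \<bar>A - B * sqrt 2\<bar>" by blast
  have "(a + c * sqrt 2) * (sqrt 2 - 1) ^ Suc n = (A + B * sqrt 2) * (sqrt 2 - 1)"
    using IH(1) by (simp add: mult.assoc mult.commute[of _ "(sqrt 2 - 1) ^ n"] flip: mult.assoc)
  also have "\<dots> = of_int (2 * B - A) + of_int (A - B) * sqrt 2"
    by (simp add: algebra_simps)
  finally have 1: "(a + c * sqrt 2) * (sqrt 2 - 1) ^ Suc n = of_int (2 * B - A) + of_int (A - B) * sqrt 2" .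
  have "\<bar>a - c * sqrt 2\<bar> * (sqrt 2 + 1) ^ Suc n = \<bar>A - B * sqrt 2\<bar> * \<bar>- sqrt 2 - 1\<bar>"
  proof -
    have "\<bar>- sqrt 2 - 1\<bar> = sqrt 2 + 1" using real_sqrt_ge_zero[of 2] by linarith
    then show ?thesis using IH(2) by (simp add: mult_ac)
  qed
  also have "\<dots> = \<bar>(A - B * sqrt 2) * (- sqrt 2 - 1)\<bar>" by (simp only: abs_mult)
  also have "(A - B * sqrt 2) * (- sqrt 2 - 1) = of_int (2 * B - A) - of_int (A - B) * sqrt 2"
    by (simp add: algebra_simps)
  finally show ?case using 1 by blast
qed

lemma sqrt_2_bounds: "1.4 < sqrt 2" "sqrt 2 < 1.5"
  by (rule real_less_rsqrt, simp add: power2_eq_square) (rule real_less_lsqrt, simp_all add: power2_eq_square)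

text \<open>Half the difference of the number and its conjugate confines \<open>B * sqrt 2\<close>
  to (-1/2, 2), so B is 0 or 1. The bound 3 excludes 2 + sqrt 2, whose conjugate is also below
  1.\<close>

lemma quadratic_integer_small:
  fixes A B :: int
  assumes "\<bar>A - B * sqrt 2\<bar> < 1" "0 < A + B * sqrt 2" "A + B * sqrt 2 < 3"
  shows "A = 1 \<and> B = 1"
proof -
  have s: "1.4 < sqrt 2" "sqrt 2 < 1.5"
    by (rule sqrt_2_bounds)+
  have "B * sqrt 2 < 2" "B * sqrt 2 > -1/2" using assms by linarith+
  then have "B < 2" "B > -1"
  proof -
    show "B < 2"
    proof (rule ccontr)
      assume "\<not> B < 2"
      then have "2 * sqrt 2 \<le> B * sqrt 2" by (intro mult_right_mono) auto
      with s \<open>B * sqrt 2 < 2\<close> show False by linarith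
    qed
    show "B > -1"
    proof (rule ccontr)
      assume "\<not> B > -1"
      then have "B * sqrt 2 \<le> -1 * sqrt 2" by (intro mult_right_mono) auto
      with s \<open>B * sqrt 2 > -1/2\<close> show False by linarith
    qed
  qed
  then consider "B = 0" | "B = 1" by linarith
  then show ?thesis
  proof cases
    case 1
    then show ?thesis using assms by simp
  next
    case 2
    with assms s have "real_of_int A > 0" "real_of_int A < 2" by auto
    with 2 show ?thesis by auto
  qed
qed

section \<open>Approximations of 1 and the lower bound\<close>

text \<open>For even n this is \<open>sqrt 2\<close> times the n-th Pell number, for odd n half the
  n-th Pell-Lucas number. It is the value of q when p + q and p - q are the n-th powers of
  \<open>sqrt 2 + 1\<close> and \<open>sqrt 2 - 1\<close>.\<close>

definition pell_bound :: "nat \<Rightarrow> real" where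
  "pell_bound n = ((sqrt 2 + 1) ^ n - (sqrt 2 - 1) ^ n) / 2"

lemma silver_ratio_powers: "(sqrt 2 + 1) ^ n * (sqrt 2 - 1) ^ n = (1 :: real)"
  by (simp add: algebra_simps flip: power_mult_distrib)

lemma approximation_to_one:
  assumes "normalized p q" "1 \<le> q" "q < pell_bound (Suc n)"
  shows "(sqrt 2 - 1) ^ n \<le> \<bar>q - p\<bar>"
proof (rule ccontr)
  assume "\<not> (sqrt 2 - 1) ^ n \<le> \<bar>q - p\<bar>"
  then have small: "\<bar>q - p\<bar> < (sqrt 2 - 1) ^ n" by simp
  define l m where "l = (sqrt 2 + 1) ^ n" and "m = (sqrt 2 - 1) ^ n"
  have s: "1.4 < sqrt 2" "sqrt 2 < 1.5"
    by (rule sqrt_2_bounds)+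
  have lm: "l * m = 1" "l > 0" "0 < m" "m \<le> 1"
    unfolding l_def m_def using silver_ratio_powers s by (auto intro!: power_le_one)
  have q: "2 * q < (sqrt 2 + 1) * l - (sqrt 2 - 1) * m"
    using assms(3) by (simp add: pell_bound_def l_def m_def)
  \<comment> \<open>In both normalized forms |q - p| is the absolute value of the conjugate of p +
    q.\<close>
  obtain a c :: int where ac: "p + q = a + c * sqrt 2" "\<bar>q - p\<bar> = \<bar>a - c * sqrt 2\<bar>"
    using assms(1)
  proof (cases rule: normalized_cases)
    case (1 a c)
    then show ?thesis using that[of a c] by (simp add: abs_minus_commute mult.commute)
  next
    case (2 a c)
    then show ?thesis using that[of c a] by (simp add: mult.commute)
  qed
  obtain A B :: int where AB: "(p + q) * m = A + B * sqrt 2" "\<bar>q - p\<bar> * l = \<bar>A - B * sqrt 2\<bar>"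
    using quadratic_integer_shift[of a c n] ac unfolding l_def m_def by auto
  have "\<bar>q - p\<bar> * l < m * l" using small lm(2) unfolding m_def by (intro mult_strict_right_mono) auto
  then have 1: "\<bar>A - B * sqrt 2\<bar> < 1" using AB lm by (simp add: mult.commute)
  have "p + q > 0" using small assms(2) lm(4) unfolding m_def[symmetric] by linarith
  then have 2: "0 < A + B * sqrt 2" using AB(1) lm(3) by (metis mult_pos_pos)
  \<comment> \<open>From p + q \<le> 2 q + |q - p|. After scaling by m the bound becomes at most
    (sqrt 2 + 1) + (2 - sqrt 2) = 3, the threshold of
    \<open>quadratic_integer_small\<close>.\<close>
  have "p + q < (sqrt 2 + 1) * l - (sqrt 2 - 1) * m + m"
    using small q unfolding m_def[symmetric] by linarith
  then have "(p + q) * m < ((sqrt 2 + 1) * l - (sqrt 2 - 1) * m + m) * m"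
    using lm by (intro mult_strict_right_mono) auto
  also have "\<dots> = (sqrt 2 + 1) * (l * m) + (2 - sqrt 2) * (m * m)" by (simp add: algebra_simps)
  also have "\<dots> \<le> (sqrt 2 + 1) + (2 - sqrt 2) * 1"
    using lm s by (intro add_mono mult_left_mono) (auto intro: mult_le_one)
  finally have 3: "A + B * sqrt 2 < 3" using AB by simp
  have "A = 1" "B = 1" using quadratic_integer_small[OF 1 2 3] by auto
  then have "(p + q) * m = 1 + sqrt 2" "\<bar>q - p\<bar> * l = sqrt 2 - 1" using AB s by auto
  then have "(p + q) * (l * m) = (sqrt 2 + 1) * l" "\<bar>q - p\<bar> * (l * m) = (sqrt 2 - 1) * m"
    by (metis add.commute mult.assoc mult.commute)+
  \<comment> \<open>Now 2 q \<ge> (p + q) - |q - p| = (sqrt 2 + 1) l - (sqrt 2 - 1) m, against the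
    bound on q.\<close>
  with lm q show False by (simp add: abs_if split: if_splits)
qed

lemma K_const_one_ge: "ereal ((sqrt 2 + 1) / 2) \<le> K_const 1"
proof -
  have "(sqrt 2 + 1) / 2 \<le> K"
    if ev: "\<forall>\<^sub>F N in at_top. \<exists>p q. normalized p q \<and> \<bar>q * 1 - p\<bar> < K / N \<and> 1 \<le> q \<and> q \<le> N" for K :: real
  proof -
    have s: "1.4 < sqrt 2" "sqrt 2 < 1.5"
      by (rule sqrt_2_bounds)+
    \<comment> \<open>These N lie just below the critical denominators, since
      \<open>approximation_to_one\<close> needs q strictly below \<open>pell_bound\<close>. The gap
      1 / 2 ^ n does not affect the limit.\<close>
    define f where "f n = pell_bound (Suc n) - 1 / 2 ^ n" for n
    have top: "filterlim f at_top sequentially"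
    proof (rule filterlim_at_top_mono)
      show "filterlim (\<lambda>n. real n / 2 - 1 / 2) at_top sequentially" by real_asymp
      have "real n / 2 - 1 / 2 \<le> f n" for n
      proof -
        have "1 + real (Suc n) * 1 \<le> 1 + real (Suc n) * sqrt 2"
          using s by (intro add_left_mono mult_left_mono) auto
        also have "\<dots> \<le> (1 + sqrt 2) ^ Suc n"
          by (rule Bernoulli_inequality) (use s in linarith)
        finally have "1 + real (Suc n) \<le> (sqrt 2 + 1) ^ Suc n"
          by (simp only: mult_1_right add.commute[of "sqrt 2"])
        moreover have "(sqrt 2 - 1) ^ Suc n \<le> 1" using s by (intro power_le_one) auto
        moreover have "1 / 2 ^ n \<le> (1 :: real)" by simp
        ultimately show ?thesis unfolding f_def pell_bound_def of_nat_Suc by argo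
      qed
      then show "\<forall>\<^sub>F n in sequentially. real n / 2 - 1 / 2 \<le> f n" by simp
    qed
    have "\<forall>\<^sub>F n in sequentially. f n * (sqrt 2 - 1) ^ n \<le> K"
      using filterlim_iff[THEN iffD1, OF top, rule_format, OF ev]
        filterlim_at_top_dense[THEN iffD1, OF top, rule_format, of 0]
    proof eventually_elim
      case (elim n)
      then obtain p q where pq: "normalized p q" "\<bar>q - p\<bar> < K / f n" "1 \<le> q" "q \<le> f n" by auto
      have "f n < pell_bound (Suc n)" by (simp add: f_def)
      then have "(sqrt 2 - 1) ^ n \<le> \<bar>q - p\<bar>"
        using pq by (intro approximation_to_one) auto
      also have "\<dots> < K / f n" by fact
      finally show ?case using elim by (simp add: pos_less_divide_eq mult.commute)
    qed
    moreover have "(\<lambda>n. f n * (sqrt 2 - 1) ^ n) \<longlonglongrightarrow> (sqrt 2 + 1) / 2"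
    proof -
      \<comment> \<open>The leading term is constant because the powers of \<open>sqrt 2 + 1\<close>
        and \<open>sqrt 2 - 1\<close> cancel; the others decay geometrically.\<close>
      have "f n * (sqrt 2 - 1) ^ n =
          (sqrt 2 + 1) / 2 - (sqrt 2 - 1) / 2 * ((sqrt 2 - 1) ^ n * (sqrt 2 - 1) ^ n)
            - (sqrt 2 - 1) ^ n * (1 / 2) ^ n" for n
        using silver_ratio_powers[of n]
        by (simp add: f_def pell_bound_def power_divide algebra_simps
            add_divide_distrib diff_divide_distrib)
      moreover have "(\<lambda>n. (sqrt 2 + 1) / 2 - (sqrt 2 - 1) / 2 * ((sqrt 2 - 1) ^ n * (sqrt 2 - 1) ^ n)
            - (sqrt 2 - 1) ^ n * (1 / 2) ^ n)
          \<longlonglongrightarrow> (sqrt 2 + 1) / 2 - (sqrt 2 - 1) / 2 * (0 * 0) - 0 * (0 :: real)"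
        by (intro tendsto_intros LIMSEQ_realpow_zero) (use s in auto)
      ultimately show ?thesis by simp
    qed
    ultimately show ?thesis
      by (intro tendsto_upperbound) auto
  qed
  then show ?thesis
    unfolding K_const_def by (auto intro!: Inf_greatest)
qed

theorem mainTheorem2:
  "(\<forall>\<alpha>::real. ereal \<alpha> \<notin> Q_H4 \<longrightarrow> K_const \<alpha> \<le> K_const 1) \<and>
   K_const 1 = ereal ((sqrt 2 + 1) / 2)"
  using K_const_le K_const_one_ge by (metis order_antisym)

end
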